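(* Let $R_4(n)$ be the number of partitions of $n$ with max-rook number $4$. For every integer $n>16$, $$R_4(n)\equiv\begin{cases} 0 \pmod 2, & \text{if } n\equiv 4,6 \pmod 8,\\ 1 \pmod 2, & \text{if } n\equiv 0,1,2,3,5,7 \pmod 8.\end{cases}$$
   Context: A partition $\pi$ of a positive integer $n$ is a non-increasing sequence of positive integers $(\lambda_1,\dots,\lambda_r)$ with sum $n$; $\mathscr{P}(n)$ is the set of all partitions of $n$. The Ferrers board $B_\pi$ of $\pi=(\lambda_1,\dots,\lambda_r)$ is the left-justified array of unit squares with $r$ rows whose $i$-th row from the top has $\lambda_i$ squares. Rooks placed on squares of the board are non-intersecting if no two of them lie in the same row or the same column. The max-rook number $R(\pi)$ is the maximal number of non-intersecting rooks that can be placed in $B_\pi$. For positive integers $n,k$, $R_k(n):=\#\{\pi\in\mathscr{P}(n) : R(\pi)=k\}$. *)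

theory Defs
  imports "HOL-Number_Theory.Cong"
begin

definition partitions :: "nat \<Rightarrow> nat list set" where
  "partitions n = {xs. sorted_wrt (\<ge>) xs \<and> (\<forall>x\<in>set xs. 0 < x) \<and> sum_list xs = n}"

text \<open>Squares are pairs (row, column), with rows and columns both numbered from 0.\<close>

definition ferrers_board :: "nat list \<Rightarrow> (nat \<times> nat) set" where
  "ferrers_board xs = {(i, j). i < length xs \<and> j < xs ! i}"

definition non_intersecting :: "(nat \<times> nat) set \<Rightarrow> bool" where
  "non_intersecting S \<longleftrightarrow>
     (\<forall>p\<in>S. \<forall>q\<in>S. p \<noteq> q \<longrightarrow> fst p \<noteq> fst q \<and> snd p \<noteq> snd q)"

definition max_rook :: "nat list \<Rightarrow> nat" where
  "max_rook xs = Max (card ` {S. S \<subseteq> ferrers_board xs \<and> non_intersecting S})"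

definition rook_partitions :: "nat \<Rightarrow> nat \<Rightarrow> nat" where
  "rook_partitions k n = card {xs \<in> partitions n. max_rook xs = k}"

text \<open>The maximum and the cardinality above are taken over finite sets, the former nonempty.\<close>

lemma finite_ferrers_board: "finite (ferrers_board xs)"
proof -
  have "ferrers_board xs = Sigma {..<length xs} (\<lambda>i. {..<xs ! i})"
    by (auto simp: ferrers_board_def)
  then show ?thesis by simp
qed

lemma finite_rook_placements:
  "finite {S. S \<subseteq> ferrers_board xs \<and> non_intersecting S}"
  by (rule finite_subset[of _ "Pow (ferrers_board xs)"]) (auto simp: finite_ferrers_board)

lemma empty_rook_placement:
  "{} \<in> {S. S \<subseteq> ferrers_board xs \<and> non_intersecting S}"
  by (simp add: non_intersecting_def)

lemma length_le_sum_list: "\<forall>x\<in>set xs. 0 < x \<Longrightarrow> length xs \<le> sum_list (xs :: nat list)"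
  by (induction xs) auto

lemma finite_partitions: "finite (partitions n)"
proof (rule finite_subset)
  show "partitions n \<subseteq> {xs. set xs \<subseteq> {..n} \<and> length xs \<le> n}"
    using length_le_sum_list member_le_sum_list by (fastforce simp: partitions_def)
  show "finite {xs. set xs \<subseteq> {..n} \<and> length xs \<le> n}"
    by (rule finite_lists_length_le) simp
qed

end

theory Submission
  imports Defs
begin

text \<open>
  Replace a partition by its Ferrers board, a finite down-closed set \<open>D\<close> of squares. Such a set
  holds \<open>k\<close> non-intersecting rooks iff it contains the staircase of all \<open>(i, j)\<close> with
  \<open>i + j < k\<close> (\<open>rooks_iff_staircase\<close>): the squares \<open>(i, k - 1 - i)\<close> of the staircase carry \<open>k\<close>
  rooks, and if \<open>(i, k - 1 - i)\<close> is missing from \<open>D\<close>, then \<open>i\<close> rows and \<open>k - 1 - i\<close> columns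
  cover \<open>D\<close>. So the max-rook number is \<open>4\<close> iff \<open>D\<close> contains the staircase of size \<open>4\<close> but not
  that of size \<open>5\<close>.

  This property is invariant under conjugation, an involution on the boards with \<open>n\<close> squares.
  Hence, modulo \<open>2\<close>, only the self-conjugate boards count (\<open>card_cong_card_fixpoints\<close>). One of the
  squares \<open>(0, 4)\<close>, \<open>(1, 3)\<close>, \<open>(2, 2)\<close> is missing from such a board, up to reflection. If
  \<open>(0, 4)\<close> is missing, the board lies in a \<open>4\<close> by \<open>4\<close> square, so \<open>n \<le> 16\<close>. If \<open>(2, 2)\<close> is
  missing, the board is a union of two nested symmetric hooks and is determined by the lengths
  \<open>a \<ge> b \<ge> 3\<close> of its first two rows, with \<open>n = 2 a + 2 b - 4\<close>. Otherwise \<open>(1, 3)\<close> is missing, the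
  board is a symmetric hook together with the \<open>3\<close> by \<open>3\<close> square, and \<open>n = 2 a + 3\<close>. For \<open>n > 16\<close>
  this leaves one self-conjugate board if \<open>n\<close> is odd, and \<open>n div 4 - 1\<close> of them if \<open>n\<close> is even.
\<close>

section \<open>Young diagrams and the staircase criterion\<close>

text \<open>A Young diagram as a finite set of squares (row, column), closed towards the origin.\<close>

definition young :: "(nat \<times> nat) set \<Rightarrow> bool" where
  "young D \<longleftrightarrow> finite D \<and> (\<forall>i j i' j'. (i, j) \<in> D \<longrightarrow> i' \<le> i \<longrightarrow> j' \<le> j \<longrightarrow> (i', j') \<in> D)"

text \<open>The diagram of the partition \<open>(k, k - 1, \<dots>, 1)\<close>.\<close>

definition staircase :: "nat \<Rightarrow> (nat \<times> nat) set" where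
  "staircase k = {(i, j). i + j < k}"

lemma youngD: "young D \<Longrightarrow> (i, j) \<in> D \<Longrightarrow> i' \<le> i \<Longrightarrow> j' \<le> j \<Longrightarrow> (i', j') \<in> D"
  by (auto simp: young_def)

lemma young_finite: "young D \<Longrightarrow> finite D"
  by (simp add: young_def)

text \<open>The \<open>i\<close> rows above and the \<open>j\<close> columns to the left of a missing square \<open>(i, j)\<close> cover the
  diagram, and each of these lines carries at most one rook.\<close>

lemma card_rooks_le:
  assumes "young D" "(i, j) \<notin> D" "S \<subseteq> D" "non_intersecting S"
  shows "card S \<le> i + j"
proof -
  let ?A = "{p \<in> S. fst p < i}" and ?B = "{p \<in> S. \<not> fst p < i}"
  have fin: "finite S"
    using assms young_finite finite_subset by blast
  have inj: "inj_on fst S" "inj_on snd S"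
    using assms(4) by (auto simp: inj_on_def non_intersecting_def)
  have "card ?A \<le> card {..<i}"
    by (rule card_inj_on_le[of fst]) (auto intro: inj_on_subset[OF inj(1)])
  moreover have "snd ` ?B \<subseteq> {..<j}"
  proof
    fix c assume "c \<in> snd ` ?B"
    then obtain r where "(r, c) \<in> D" "i \<le> r"
      using assms(3) by force
    then show "c \<in> {..<j}"
      using youngD[OF assms(1), of r c i j] assms(2) by force
  qed
  then have "card ?B \<le> card {..<j}"
    by (intro card_inj_on_le[of snd]) (auto intro: inj_on_subset[OF inj(2)])
  moreover have "S = ?A \<union> ?B"
    by auto
  then have "card S \<le> card ?A + card ?B"
    using card_Un_le[of ?A ?B] by simp
  ultimately show ?thesis
    by simp
qed

lemma rooks_iff_staircase:
  assumes "young D"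
  shows "(\<exists>S\<subseteq>D. non_intersecting S \<and> k \<le> card S) \<longleftrightarrow> staircase k \<subseteq> D"
proof
  assume "\<exists>S\<subseteq>D. non_intersecting S \<and> k \<le> card S"
  then obtain S where S: "S \<subseteq> D" "non_intersecting S" "k \<le> card S"
    by blast
  show "staircase k \<subseteq> D"
  proof (rule ccontr)
    assume "\<not> staircase k \<subseteq> D"
    then obtain i j where "i + j < k" "(i, j) \<notin> D"
      by (auto simp: staircase_def)
    then show False
      using card_rooks_le[OF assms, of i j S] S by simp
  qed
next
  assume st: "staircase k \<subseteq> D"
  let ?S = "(\<lambda>i. (i, k - 1 - i)) ` {..<k}"
  have "card ?S = k"
    by (subst card_image) (auto simp: inj_on_def)
  moreover have "non_intersecting ?S"
    by (auto simp: non_intersecting_def)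
  moreover have "?S \<subseteq> D"
    using st by (auto simp: staircase_def)
  ultimately show "\<exists>S\<subseteq>D. non_intersecting S \<and> k \<le> card S"
    by (metis order_refl)
qed

section \<open>Partitions as Young diagrams\<close>

lemma down_closed_eq_lessThan:
  fixes A :: "nat set"
  assumes "finite A" "\<And>i j. j \<in> A \<Longrightarrow> i \<le> j \<Longrightarrow> i \<in> A"
  shows "A = {..<card A}"
proof -
  obtain m where "A = {..<m}"
  proof (cases "A = {}")
    case True
    then show ?thesis using that[of 0] by simp
  next
    case False
    then have "Max A \<in> A"
      using assms(1) by simp
    then have "A = {..<Suc (Max A)}"
      using assms(2)[of "Max A"] Max_ge[OF assms(1)] by (auto simp: less_Suc_eq_le)
    then show ?thesis using that by blast
  qed
  then show ?thesis by simp
qed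

text \<open>The number of squares in row \<open>i\<close>; it is \<open>0\<close> below the last row.\<close>

definition row_length :: "(nat \<times> nat) set \<Rightarrow> nat \<Rightarrow> nat" where
  "row_length D i = card {j. (i, j) \<in> D}"

lemma young_row_iff:
  assumes "young D"
  shows "(i, j) \<in> D \<longleftrightarrow> j < row_length D i"
proof -
  have "finite {j. (i, j) \<in> D}"
    using finite_subset[of "{j. (i, j) \<in> D}" "snd ` D"] young_finite[OF assms] by force
  then have "{j. (i, j) \<in> D} = {..<row_length D i}"
    unfolding row_length_def by (rule down_closed_eq_lessThan) (auto intro: youngD[OF assms])
  then show ?thesis by blast
qed

text \<open>The length of the first column, which is the number of nonempty rows of a Young diagram.\<close>

definition column_length :: "(nat \<times> nat) set \<Rightarrow> nat" where
  "column_length D = card {i. (i, 0) \<in> D}"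

lemma young_column_iff:
  assumes "young D"
  shows "(i, 0) \<in> D \<longleftrightarrow> i < column_length D"
proof -
  have "finite {i. (i, 0) \<in> D}"
    using finite_subset[of "{i. (i, 0) \<in> D}" "fst ` D"] young_finite[OF assms] by force
  then have "{i. (i, 0) \<in> D} = {..<column_length D}"
    unfolding column_length_def by (rule down_closed_eq_lessThan) (auto intro: youngD[OF assms])
  then show ?thesis by blast
qed

text \<open>The list of row lengths of a Young diagram, the inverse of the Ferrers board.\<close>

definition rows :: "(nat \<times> nat) set \<Rightarrow> nat list" where
  "rows D = map (row_length D) [0..<column_length D]"

lemma ferrers_board_rows:
  assumes "young D"
  shows "ferrers_board (rows D) = D"
proof -
  have "(i, j) \<in> D \<longleftrightarrow> i < column_length D \<and> j < row_length D i" for i j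
    using young_row_iff[OF assms] young_column_iff[OF assms] youngD[OF assms, of i j i 0] by auto
  then show ?thesis
    by (auto simp: ferrers_board_def rows_def)
qed

lemma card_ferrers_board: "card (ferrers_board xs) = sum_list xs"
proof -
  have "ferrers_board xs = Sigma {..<length xs} (\<lambda>i. {..<xs ! i})"
    by (auto simp: ferrers_board_def)
  then have "card (ferrers_board xs) = (\<Sum>i<length xs. xs ! i)"
    by simp
  then show ?thesis
    by (simp add: sum_list_sum_nth atLeast0LessThan)
qed

lemma young_ferrers_board:
  assumes "xs \<in> partitions n"
  shows "young (ferrers_board xs)"
proof -
  have mono: "xs ! i \<le> xs ! i'" if "i' \<le> i" "i < length xs" for i i'
    using assms that by (cases "i' = i") (auto simp: partitions_def sorted_wrt_iff_nth_less)
  have "(i', j') \<in> ferrers_board xs" if "(i, j) \<in> ferrers_board xs" "i' \<le> i" "j' \<le> j" for i j i' j'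
    using that mono[of i' i] by (simp add: ferrers_board_def)
  then show ?thesis
    unfolding young_def using finite_ferrers_board by blast
qed

lemma rows_ferrers_board:
  assumes "xs \<in> partitions n"
  shows "rows (ferrers_board xs) = xs"
proof -
  have "{i. (i, 0) \<in> ferrers_board xs} = {..<length xs}"
    using assms by (auto simp: ferrers_board_def partitions_def)
  moreover have "row_length (ferrers_board xs) i = xs ! i" if "i < length xs" for i
    using that by (simp add: row_length_def ferrers_board_def lessThan_def[symmetric])
  ultimately show ?thesis
    by (auto simp: rows_def column_length_def intro: nth_equalityI)
qed

lemma rows_in_partitions:
  assumes "young D"
  shows "rows D \<in> partitions (card D)"
proof -
  have "row_length D i \<le> row_length D i'" if "i' \<le> i" for i i'
    using that youngD[OF assms, of i "row_length D i'" i' "row_length D i'"]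
    unfolding young_row_iff[OF assms] by (meson not_less order_refl)
  then have "sorted_wrt (\<ge>) (rows D)"
    by (auto simp: rows_def sorted_wrt_iff_nth_less)
  moreover have "\<forall>x\<in>set (rows D). 0 < x"
    using young_row_iff[OF assms] young_column_iff[OF assms] by (auto simp: rows_def)
  moreover have "sum_list (rows D) = card D"
    using card_ferrers_board[of "rows D"] ferrers_board_rows[OF assms] by simp
  ultimately show ?thesis
    by (simp add: partitions_def)
qed

lemma le_max_rook_iff:
  assumes "xs \<in> partitions n"
  shows "k \<le> max_rook xs \<longleftrightarrow> staircase k \<subseteq> ferrers_board xs"
proof -
  have "k \<le> max_rook xs \<longleftrightarrow> (\<exists>S\<subseteq>ferrers_board xs. non_intersecting S \<and> k \<le> card S)"
    unfolding max_rook_def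
    using finite_rook_placements[of xs] empty_rook_placement[of xs]
    by (subst Max_ge_iff) auto
  then show ?thesis
    using rooks_iff_staircase[OF young_ferrers_board[OF assms]] by simp
qed

text \<open>The Young diagrams with \<open>n\<close> squares and max-rook number \<open>k\<close>, the latter expressed by
  staircases.\<close>

definition rook_diagrams :: "nat \<Rightarrow> nat \<Rightarrow> (nat \<times> nat) set set" where
  "rook_diagrams k n = {D. young D \<and> card D = n \<and> staircase k \<subseteq> D \<and> \<not> staircase (Suc k) \<subseteq> D}"

lemma bij_betw_ferrers_board:
  "bij_betw ferrers_board {xs \<in> partitions n. max_rook xs = k} (rook_diagrams k n)"
proof (rule bij_betw_byWitness[where f' = rows])
  have eq: "max_rook xs = k \<longleftrightarrow> k \<le> max_rook xs \<and> \<not> Suc k \<le> max_rook xs" for xs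
    by auto
  show "ferrers_board ` {xs \<in> partitions n. max_rook xs = k} \<subseteq> rook_diagrams k n"
    unfolding eq rook_diagrams_def
    by (auto simp: le_max_rook_iff young_ferrers_board card_ferrers_board) (simp add: partitions_def)
  show "rows ` rook_diagrams k n \<subseteq> {xs \<in> partitions n. max_rook xs = k}"
    unfolding eq rook_diagrams_def
    by (auto simp: le_max_rook_iff[OF rows_in_partitions] ferrers_board_rows rows_in_partitions)
qed (auto simp: rows_ferrers_board ferrers_board_rows rook_diagrams_def)

lemma rook_partitions_eq: "rook_partitions k n = card (rook_diagrams k n)"
  unfolding rook_partitions_def by (rule bij_betw_same_card[OF bij_betw_ferrers_board])

lemma finite_rook_diagrams: "finite (rook_diagrams k n)"
  using bij_betw_finite[OF bij_betw_ferrers_board[of n k]] finite_partitions[of n] by simp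

section \<open>Reduction to self-conjugate diagrams\<close>

lemma even_card_involution:
  assumes "finite A" "\<And>x. x \<in> A \<Longrightarrow> f x \<in> A" "\<And>x. x \<in> A \<Longrightarrow> f (f x) = x"
    "\<And>x. x \<in> A \<Longrightarrow> f x \<noteq> x"
  shows "even (card A)"
  using assms
proof (induction A rule: finite_psubset_induct)
  case (psubset A)
  show ?case
  proof (cases "A = {}")
    case False
    then obtain x where x: "x \<in> A" by blast
    let ?B = "A - {x, f x}"
    have "even (card ?B)"
    proof (rule psubset.IH)
      show "?B \<subset> A" using x by blast
      show "f y \<in> ?B" if "y \<in> ?B" for y
        using that x psubset.prems by (metis Diff_iff insert_iff singletonD)
    qed (use psubset.prems in auto)
    moreover have "card A = card ?B + 2"
    proof -
      have "card {x, f x} = 2" and sub: "{x, f x} \<subseteq> A"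
        using x psubset.prems(1,3)[OF x] by auto
      then show ?thesis
        using card_Diff_subset[of "{x, f x}" A] card_mono[OF psubset.hyps sub] by simp
    qed
    ultimately show ?thesis by simp
  qed simp
qed

lemma card_cong_card_fixpoints:
  assumes "finite A" "\<And>x. x \<in> A \<Longrightarrow> f x \<in> A" "\<And>x. x \<in> A \<Longrightarrow> f (f x) = x"
  shows "[card A = card {x \<in> A. f x = x}] (mod 2)"
proof -
  have "even (card {x \<in> A. f x \<noteq> x})"
    by (rule even_card_involution[where f = f]) (use assms in auto)
  moreover have "card A = card {x \<in> A. f x = x} + card {x \<in> A. f x \<noteq> x}"
    using assms(1) by (subst card_Un_disjoint[symmetric]) (auto intro: arg_cong[where f = card])
  ultimately show ?thesis
    by (auto simp: cong_def mod_add_eq elim!: evenE)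
qed

lemma conjugate_rook_diagrams:
  assumes "D \<in> rook_diagrams k n"
  shows "D\<inverse> \<in> rook_diagrams k n"
proof -
  have "young (D\<inverse>) \<longleftrightarrow> young D"
    by (auto simp: young_def)
  moreover have "staircase m \<subseteq> D\<inverse> \<longleftrightarrow> staircase m \<subseteq> D" for m
    by (auto simp: staircase_def add.commute subset_iff)
  ultimately show ?thesis
    using assms by (auto simp: rook_diagrams_def)
qed

lemma rook_partitions_cong:
  "[rook_partitions k n = card {D \<in> rook_diagrams k n. D\<inverse> = D}] (mod 2)"
  unfolding rook_partitions_eq
  by (rule card_cong_card_fixpoints)
    (auto simp: finite_rook_diagrams intro: conjugate_rook_diagrams)

section \<open>The self-conjugate diagrams with max-rook number four\<close>

text \<open>For \<open>2 \<le> b \<le> a\<close>, the self-conjugate diagram without the square \<open>(2, 2)\<close> whose first two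
  rows have lengths \<open>a\<close> and \<open>b\<close>.\<close>

definition two_hooks :: "nat \<Rightarrow> nat \<Rightarrow> (nat \<times> nat) set" where
  "two_hooks a b = {(i, j). i = 0 \<and> j < a \<or> j = 0 \<and> i < a \<or> i = 1 \<and> j < b \<or> j = 1 \<and> i < b}"

text \<open>For \<open>3 \<le> a\<close>, the self-conjugate diagram with first row of length \<open>a\<close> that contains the
  \<open>3\<close> by \<open>3\<close> square but not the square \<open>(1, 3)\<close>.\<close>

definition hook_square :: "nat \<Rightarrow> (nat \<times> nat) set" where
  "hook_square a = {(i, j). i = 0 \<and> j < a \<or> j = 0 \<and> i < a \<or> i < 3 \<and> j < 3}"

lemma card_two_hooks:
  assumes "2 \<le> b" "b \<le> a"
  shows "finite (two_hooks a b)" "card (two_hooks a b) = 2 * a + 2 * b - 4"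
proof -
  have eq: "two_hooks a b =
    ({0} \<times> {..<a} \<union> {1..<a} \<times> {0}) \<union> ({1} \<times> {1..<b} \<union> {2..<b} \<times> {1})"
    using assms by (auto simp: two_hooks_def)
  show "finite (two_hooks a b)"
    unfolding eq by simp
  show "card (two_hooks a b) = 2 * a + 2 * b - 4"
    unfolding eq using assms by (simp add: card_Un_disjoint card_cartesian_product disjoint_iff)
qed

lemma card_hook_square:
  assumes "3 \<le> a"
  shows "finite (hook_square a)" "card (hook_square a) = 2 * a + 3"
proof -
  have eq: "hook_square a = ({0} \<times> {..<a} \<union> {1..<a} \<times> {0}) \<union> {1..<3} \<times> {1..<3}"
    using assms by (auto simp: hook_square_def)
  show "finite (hook_square a)"
    unfolding eq by simp
  show "card (hook_square a) = 2 * a + 3"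
    unfolding eq using assms by (simp add: card_Un_disjoint card_cartesian_product disjoint_iff)
qed

lemma two_hooks_rook_diagram:
  assumes "3 \<le> b" "b \<le> a" "4 \<le> a"
  shows "two_hooks a b \<in> rook_diagrams 4 (2 * a + 2 * b - 4)" "(two_hooks a b)\<inverse> = two_hooks a b"
proof -
  have "young (two_hooks a b)"
    unfolding young_def using assms card_two_hooks[of b a] by (auto simp: two_hooks_def)
  moreover have "staircase 4 \<subseteq> two_hooks a b"
    using assms by (auto simp: two_hooks_def staircase_def)
  moreover have "(2, 2) \<in> staircase (Suc 4) - two_hooks a b"
    by (auto simp: two_hooks_def staircase_def)
  ultimately show "two_hooks a b \<in> rook_diagrams 4 (2 * a + 2 * b - 4)"
    using card_two_hooks(2)[of b a] assms unfolding rook_diagrams_def by auto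
  show "(two_hooks a b)\<inverse> = two_hooks a b"
    by (auto simp: two_hooks_def)
qed

lemma hook_square_rook_diagram:
  assumes "4 \<le> a"
  shows "hook_square a \<in> rook_diagrams 4 (2 * a + 3)" "(hook_square a)\<inverse> = hook_square a"
proof -
  have "young (hook_square a)"
    unfolding young_def using assms card_hook_square[of a] by (auto simp: hook_square_def)
  moreover have "staircase 4 \<subseteq> hook_square a"
    using assms by (auto simp: hook_square_def staircase_def)
  moreover have "(1, 3) \<in> staircase (Suc 4) - hook_square a"
    by (auto simp: hook_square_def staircase_def)
  ultimately show "hook_square a \<in> rook_diagrams 4 (2 * a + 3)"
    using card_hook_square(2)[of a] assms unfolding rook_diagrams_def by auto
  show "(hook_square a)\<inverse> = hook_square a"
    by (auto simp: hook_square_def)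
qed

text \<open>The hypothesis \<open>n > 16\<close> excludes the diagrams inside the \<open>4\<close> by \<open>4\<close> square, which need not
  have either of the two shapes.\<close>

lemma self_conjugate_cases:
  assumes D: "D \<in> rook_diagrams 4 n" and sym: "D\<inverse> = D" and n: "n > 16"
  obtains a b where "D = two_hooks a b" "3 \<le> b" "b \<le> a" "4 \<le> a"
  | a where "D = hook_square a" "4 \<le> a"
proof -
  have young: "young D" and card: "card D = n" and st4: "staircase 4 \<subseteq> D"
    and st5: "\<not> staircase 5 \<subseteq> D"
    using D by (auto simp: rook_diagrams_def)
  note closed = youngD[OF young]
  have swap: "(i, j) \<in> D \<longleftrightarrow> (j, i) \<in> D" for i j
    using sym by (metis converse_iff)
  define a b where "a = row_length D 0" and "b = row_length D 1"
  have row0: "(0, j) \<in> D \<longleftrightarrow> j < a" and row1: "(1, j) \<in> D \<longleftrightarrow> j < b" for j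
    by (simp_all add: a_def b_def young_row_iff[OF young])
  have "(0, 3) \<in> D" "(1, 2) \<in> D"
    using st4 by (auto simp: staircase_def)
  then have a4: "4 \<le> a" and b3: "3 \<le> b"
    using row0 row1 by force+
  have "\<not> a < b"
    using row0[of a] row1[of a] closed[of 1 a 0 a] by auto
  then have ba: "b \<le> a" by simp
  have col0: "(j, 0) \<in> D \<longleftrightarrow> j < a" and col1: "(j, 1) \<in> D \<longleftrightarrow> j < b" for j
    using swap[of j 0] swap[of j 1] row0 row1 by simp_all
  have "(0, 4) \<in> D"
  proof (rule ccontr)
    assume *: "(0, 4) \<notin> D"
    have "D \<subseteq> {..<4} \<times> {..<4}"
    proof (clarify)
      fix i j assume ij: "(i, j) \<in> D"
      have "j < 4" using * closed[OF ij, of 0 4] by force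
      moreover have "i < 4" using * swap[of 0 4] closed[OF ij, of 4 0] by force
      ultimately show "i \<in> {..<4} \<and> j \<in> {..<4}" by simp
    qed
    then have "card D \<le> card ({..<4::nat} \<times> {..<4::nat})"
      by (intro card_mono) auto
    then show False using card n by (simp add: card_cartesian_product)
  qed
  show thesis
  proof (cases "(2, 2) \<in> D")
    case False
    have small: "i < 2 \<or> j < 2" if "(i, j) \<in> D" for i j
      using False closed[OF that, of 2 2] by force
    have "(i, j) \<in> D \<longleftrightarrow> (i, j) \<in> two_hooks a b" for i j
    proof (cases "i < 2 \<or> j < 2")
      case True
      then consider "i = 0" | "i = 1" | "j = 0" | "j = 1" by linarith
      then show ?thesis
        using ba a4 b3 row0 row1 col0 col1
        by cases (auto simp: two_hooks_def)
    next
      case False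
      then show ?thesis using small by (auto simp: two_hooks_def)
    qed
    then have "D = two_hooks a b" by auto
    then show thesis using that(1) a4 b3 ba by blast
  next
    case True
    have "(1, 3) \<notin> D"
    proof
      assume *: "(1, 3) \<in> D"
      have "(i, j) \<in> D" if "i + j < 5" for i j
      proof -
        have "i = 0 \<or> i = 1 \<or> i = 2 \<or> i = 3 \<or> i = 4"
          using that by linarith
        then show ?thesis
          using * True \<open>(0, 4) \<in> D\<close> swap[of 1 3] swap[of 0 4] that
            closed[of 0 4 i j] closed[of 1 3 i j] closed[of 2 2 i j] closed[of 3 1 i j]
            closed[of 4 0 i j]
          by (elim disjE) simp_all
      qed
      then show False using st5 by (auto simp: staircase_def)
    qed
    then have small: "i = 0 \<or> j < 3" "j = 0 \<or> i < 3" if "(i, j) \<in> D" for i j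
      using closed[OF that, of 1 3] closed[OF that, of 3 1] swap[of 1 3] by force+
    have "(i, j) \<in> D \<longleftrightarrow> (i, j) \<in> hook_square a" for i j
    proof (cases "i = 0 \<or> j = 0")
      case True
      then show ?thesis
        using row0[of j] col0[of i] a4
        by (elim disjE) (simp_all add: hook_square_def, linarith+)
    next
      case False
      have "i < 3 \<and> j < 3" if "(i, j) \<in> D"
        using False small[OF that] by blast
      moreover have "(i, j) \<in> D" if "i < 3 \<and> j < 3"
        using closed[OF True, of i j] that by simp
      ultimately have "(i, j) \<in> D \<longleftrightarrow> i < 3 \<and> j < 3"
        by blast
      then show ?thesis
        using False by (simp add: hook_square_def)
    qed
    then have "D = hook_square a" by auto
    then show thesis using that(2) a4 by blast
  qed
qed

lemma two_hooks_inj: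
  assumes "two_hooks a b = two_hooks a' b'" "2 \<le> b" "2 \<le> b'"
  shows "b = b'"
proof -
  \<comment> \<open>The first square is dropped, as the first column may contain it even when \<open>b = 0\<close>.\<close>
  have row: "{j. (1, j) \<in> two_hooks a b} - {0} = {1..<b}" for a b
    by (auto simp: two_hooks_def)
  have "{1..<b} = {1..<b'}"
    using row[of a b] row[of a' b'] assms(1) by simp
  then have "b - 1 = b' - 1"
    by (metis card_atLeastLessThan)
  then show ?thesis using assms by simp
qed

lemma card_self_conjugate_odd:
  assumes "n > 16" "odd n"
  shows "card {D \<in> rook_diagrams 4 n. D\<inverse> = D} = 1"
proof -
  have "{D \<in> rook_diagrams 4 n. D\<inverse> = D} = {hook_square ((n - 3) div 2)}" (is "?L = ?R")
  proof
    show "?L \<subseteq> ?R"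
    proof clarify
      fix D assume D: "D \<in> rook_diagrams 4 n" and "D\<inverse> = D"
      then have card: "card D = n" by (simp add: rook_diagrams_def)
      from D \<open>D\<inverse> = D\<close> assms(1) show "D = hook_square ((n - 3) div 2)"
      proof (cases rule: self_conjugate_cases)
        case (1 a b)
        then show ?thesis using card card_two_hooks[of b a] assms by auto
      next
        case (2 a)
        then show ?thesis using card card_hook_square[of a] by auto
      qed
    qed
    have "2 * ((n - 3) div 2) + 3 = n" "4 \<le> (n - 3) div 2"
      using assms by presburger+
    then show "?R \<subseteq> ?L"
      using hook_square_rook_diagram[of "(n - 3) div 2"] by auto
  qed
  then show ?thesis by simp
qed

lemma card_self_conjugate_even:
  assumes "n > 16" "even n"
  shows "card {D \<in> rook_diagrams 4 n. D\<inverse> = D} = n div 4 - 1"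
proof -
  define h where "h = (\<lambda>b. two_hooks (n div 2 + 2 - b) b)"
  \<comment> \<open>The bound on \<open>b\<close> says that \<open>b \<le> a\<close> for \<open>a = n div 2 + 2 - b\<close>.\<close>
  have "{D \<in> rook_diagrams 4 n. D\<inverse> = D} = h ` {3..n div 4 + 1}" (is "?L = ?R")
  proof
    show "?L \<subseteq> ?R"
    proof clarify
      fix D assume D: "D \<in> rook_diagrams 4 n" and "D\<inverse> = D"
      then have card: "card D = n" by (simp add: rook_diagrams_def)
      from D \<open>D\<inverse> = D\<close> assms(1) show "D \<in> h ` {3..n div 4 + 1}"
      proof (cases rule: self_conjugate_cases)
        case (1 a b)
        then have "n = 2 * a + 2 * b - 4" using card card_two_hooks[of b a] by auto
        then have "a = n div 2 + 2 - b" "b \<in> {3..n div 4 + 1}"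
          using 1 by auto
        then show ?thesis using 1 by (auto simp: h_def)
      next
        case (2 a)
        then show ?thesis using card card_hook_square[of a] assms by auto
      qed
    qed
    show "?R \<subseteq> ?L"
    proof clarify
      fix b assume b: "b \<in> {3..n div 4 + 1}"
      define a where "a = n div 2 + 2 - b"
      have "2 * a + 2 * b - 4 = n" "3 \<le> b" "b \<le> a" "4 \<le> a"
        using b assms unfolding a_def by auto
      then show "h b \<in> rook_diagrams 4 n \<and> (h b)\<inverse> = h b"
        using two_hooks_rook_diagram[of b a] by (simp add: h_def a_def)
    qed
  qed
  moreover have "inj_on h {3..n div 4 + 1}"
    by (rule inj_onI) (auto simp: h_def dest: two_hooks_inj)
  ultimately show ?thesis by (simp add: card_image)
qed

theorem theorem4p6:
  fixes n :: nat
  assumes "n > 16"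
  shows "(n mod 8 \<in> {4, 6} \<longrightarrow> [rook_partitions 4 n = 0] (mod 2)) \<and>
         (n mod 8 \<in> {0, 1, 2, 3, 5, 7} \<longrightarrow> [rook_partitions 4 n = 1] (mod 2))"
proof (cases "even n")
  case True
  \<comment> \<open>The parity of \<open>n div 4 - 1\<close> depends only on whether \<open>r < 4\<close>.\<close>
  define q r where "q = n div 8" and "r = n mod 8"
  have n: "n = 8 * q + r" "r < 8"
    by (simp_all add: q_def r_def)
  have "even r"
    using True n by simp
  then have "r = 0 \<or> r = 2 \<or> r = 4 \<or> r = 6"
    using \<open>r < 8\<close> by presburger
  moreover have "rook_partitions 4 n mod 2 = (n div 4 - 1) mod 2"
    using rook_partitions_cong[of 4 n] card_self_conjugate_even[OF assms True] by (simp add: cong_def)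
  moreover have "n div 4 - 1 = 2 * (q - 1) + (if r < 4 then 1 else 2)"
    using n assms by auto
  ultimately show ?thesis
    unfolding r_def[symmetric] by (auto simp: cong_def)
next
  case False
  have "rook_partitions 4 n mod 2 = 1"
    using rook_partitions_cong[of 4 n] card_self_conjugate_odd[OF assms False] by (simp add: cong_def)
  moreover have "odd (n mod 8)"
    using False by (simp add: dvd_mod_iff)
  then have "n mod 8 \<notin> {4, 6}"
    by auto
  ultimately show ?thesis
    by (simp add: cong_def)
qed

end
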